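(* Let $\mathcal{C}_2$ be the two-dimensional comb, let $h(x)=x^2$ for $x\in\mathbb{N}_0$, and let $$B_m=\{(x,y)\in\mathcal{C}_2:\ |x|\le m,\ |y|\le h(m-|x|)\},\qquad m\in\mathbb{N}.$$ Then the harmonic measure $\nu_{m,o}$ of $B_m$ is the uniform measure on the inner boundary $\partial B_m$.
   Context: $\mathbb{N}_0=\{0,1,2,\dots\}$. The two-dimensional comb $\mathcal{C}_2$ is the graph with vertex set $\mathbb{Z}^2$ obtained from the square lattice $\mathbb{Z}^2$ by removing all horizontal edges except those on the $x$-axis. Thus $(x,y)\sim(x,y\pm1)$ for all $(x,y)$, and $(x,0)\sim(x\pm1,0)$. The root is $o=(0,0)$. The inner boundary of $B_m$ is $\partial B_m=\{z\in B_m:\ z\text{ has a neighbour } y \text{ in } \mathcal{C}_2 \text{ with } y\notin B_m\}$. Simple random walk on $\mathcal{C}_2$ moves at each step to a uniformly chosen neighbour of the current vertex. For $z\in\partial B_m$, $\nu_{m,o}(z)$ denotes the probability that the simple random walk $(X_t)_{t\ge0}$ started at $o$ first hits $\partial B_m$ at $z$, i.e. $\nu_{m,o}(z)=\mathbb{P}_o[X_T=z]$ with $T=\inf\{t\ge0: X_t\in\partial B_m\}$. The measure $\nu_{m,o}$ on $\partial B_m$ is called the harmonic measure of $B_m$. *)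

theory Defs
  imports "HOL-Probability.Probability"
begin

definition comb_adj :: "int \<times> int \<Rightarrow> int \<times> int \<Rightarrow> bool" where
  "comb_adj = (\<lambda>(x, y) (x', y').
     (x = x' \<and> \<bar>y - y'\<bar> = 1) \<or> (y = 0 \<and> y' = 0 \<and> \<bar>x - x'\<bar> = 1))"

definition neighbours :: "('v \<Rightarrow> 'v \<Rightarrow> bool) \<Rightarrow> 'v \<Rightarrow> 'v set" where
  "neighbours E v = {w. E v w}"

definition inner_boundary :: "('v \<Rightarrow> 'v \<Rightarrow> bool) \<Rightarrow> 'v set \<Rightarrow> 'v set" where
  "inner_boundary E B = {z \<in> B. \<exists>y. E z y \<and> y \<notin> B}"

definition height :: "nat \<Rightarrow> nat" where
  "height x = x\<^sup>2"

definition comb_ball :: "nat \<Rightarrow> (int \<times> int) set" where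
  "comb_ball m = {(x, y). \<bar>x\<bar> \<le> int m \<and> \<bar>y\<bar> \<le> int (height (nat (int m - \<bar>x\<bar>)))}"

text \<open>
  \<open>simple_random_walk E v M X\<close>: the process \<open>X\<close> on the probability space \<open>M\<close> is a simple random
  walk started at \<open>v\<close> on the graph with edge relation \<open>E\<close>, whose vertex set is the countable type
  \<open>'v\<close>.  Conditionally on the whole past, the next position is uniform among the neighbours of the
  current one.  Every vertex is meant to have finitely many, and at least one, neighbours, since
  otherwise \<open>pmf_of_set\<close> is unspecified.
\<close>
definition simple_random_walk ::
  "('v::countable \<Rightarrow> 'v \<Rightarrow> bool) \<Rightarrow> 'v \<Rightarrow> 'a measure \<Rightarrow> (nat \<Rightarrow> 'a \<Rightarrow> 'v) \<Rightarrow> bool" where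
  "simple_random_walk E v M X \<longleftrightarrow>
     prob_space M \<and>
     (\<forall>t. X t \<in> M \<rightarrow>\<^sub>M count_space UNIV) \<and>
     (AE \<omega> in M. X 0 \<omega> = v) \<and>
     (\<forall>t p w. \<P>(\<omega> in M. \<forall>s\<le>t. X s \<omega> = p s) > 0 \<longrightarrow>
        \<P>(\<omega> in M. X (Suc t) \<omega> = w \<bar> \<forall>s\<le>t. X s \<omega> = p s)
          = pmf (pmf_of_set (neighbours E (p t))) w)"

text \<open>
  The event that the process reaches \<open>A\<close> and is at \<open>z\<close> at the first time it does.  The first
  conjunct is needed because the infimum of the empty set of natural numbers is not infinite.
\<close>
definition first_hit_at :: "(nat \<Rightarrow> 'a \<Rightarrow> 'v) \<Rightarrow> 'v set \<Rightarrow> 'v \<Rightarrow> 'a \<Rightarrow> bool" where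
  "first_hit_at X A z \<omega> \<longleftrightarrow> (\<exists>t. X t \<omega> \<in> A) \<and> X (Inf {t. X t \<omega> \<in> A}) \<omega> = z"

definition harmonic_measure ::
  "('v \<Rightarrow> 'v \<Rightarrow> bool) \<Rightarrow> 'a measure \<Rightarrow> (nat \<Rightarrow> 'a \<Rightarrow> 'v) \<Rightarrow> 'v set \<Rightarrow> 'v measure" where
  "harmonic_measure E M X B =
     point_measure (inner_boundary E B)
       (\<lambda>z. ennreal \<P>(\<omega> in M. first_hit_at X (inner_boundary E B) z \<omega>))"

text \<open>
  Simple random walks exist: give every vertex, at every time, an independent uniformly chosen
  neighbour, and let the walk follow these choices.
\<close>
primrec follow :: "'v \<Rightarrow> nat \<Rightarrow> (nat \<times> 'v \<Rightarrow> 'v) \<Rightarrow> 'v" where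
  "follow v 0 \<omega> = v"
| "follow v (Suc t) \<omega> = \<omega> (t, follow v t \<omega>)"

lemma follow_path_iff:
  "(\<forall>s\<le>t. follow v s \<omega> = p s) \<longleftrightarrow> p 0 = v \<and> (\<forall>s<t. \<omega> (s, p s) = p (Suc s))"
proof (induction t)
  case (Suc t)
  have "(\<forall>s\<le>Suc t. follow v s \<omega> = p s) \<longleftrightarrow>
        (\<forall>s\<le>t. follow v s \<omega> = p s) \<and> \<omega> (t, follow v t \<omega>) = p (Suc t)"
    by (auto simp: le_Suc_eq)
  also have "\<dots> \<longleftrightarrow> (\<forall>s\<le>t. follow v s \<omega> = p s) \<and> \<omega> (t, p t) = p (Suc t)"
    by auto
  finally show ?case
    unfolding Suc.IH by (auto simp: less_Suc_eq)
qed auto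

lemma simple_random_walk_follow:
  fixes E :: "'v::countable \<Rightarrow> 'v \<Rightarrow> bool"
  shows "simple_random_walk E v
    (\<Pi>\<^sub>M i\<in>UNIV. measure_pmf (pmf_of_set (neighbours E (snd i)))) (follow v)"
proof -
  define K where "K = (\<lambda>i :: nat \<times> 'v. measure_pmf (pmf_of_set (neighbours E (snd i))))"
  interpret product_prob_space K UNIV
    by (rule product_prob_spaceI) (simp add: K_def measure_pmf.prob_space_axioms)
  let ?M = "PiM UNIV K"
  have sp: "space ?M = UNIV"
    by (auto simp: space_PiM K_def)
  have comp: "(\<lambda>\<omega>. \<omega> i) \<in> ?M \<rightarrow>\<^sub>M count_space UNIV" for i
    using measurable_component_singleton[of i UNIV K] by (simp add: K_def)
  have meas: "follow v t \<in> ?M \<rightarrow>\<^sub>M count_space UNIV" for t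
  proof (induction t)
    case (Suc t)
    have "(\<lambda>\<omega>. (\<lambda>w \<omega>. \<omega> (t, w)) (follow v t \<omega>) \<omega>) \<in> ?M \<rightarrow>\<^sub>M count_space UNIV"
      by (rule measurable_compose_countable[OF _ Suc.IH]) (rule comp)
    then show ?case by simp
  qed simp
  have path: "\<P>(\<omega> in ?M. \<forall>s\<le>t. follow v s \<omega> = p s) =
      (if p 0 = v then \<Prod>s<t. pmf (pmf_of_set (neighbours E (p s))) (p (Suc s)) else 0)" for t p
  proof (cases "p 0 = v")
    case True
    let ?J = "(\<lambda>s. (s, p s)) ` {..<t}"
    have "{\<omega> \<in> space ?M. \<forall>s\<le>t. follow v s \<omega> = p s} =
        emb UNIV ?J (\<Pi>\<^sub>E i\<in>?J. {p (Suc (fst i))})"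
      unfolding follow_path_iff using True sp by (auto simp: prod_emb_def PiE_iff K_def)
    also have "measure ?M \<dots> = (\<Prod>i\<in>?J. measure (K i) {p (Suc (fst i))})"
      by (rule measure_PiM_emb) (auto simp: K_def)
    also have "\<dots> = (\<Prod>s<t. pmf (pmf_of_set (neighbours E (p s))) (p (Suc s)))"
      by (subst prod.reindex) (auto simp: inj_on_def K_def measure_pmf_single)
    finally show ?thesis using True by simp
  qed (simp add: follow_path_iff)
  have "\<P>(\<omega> in ?M. follow v (Suc t) \<omega> = w \<bar> \<forall>s\<le>t. follow v s \<omega> = p s)
          = pmf (pmf_of_set (neighbours E (p t))) w"
    if pos: "\<P>(\<omega> in ?M. \<forall>s\<le>t. follow v s \<omega> = p s) > 0" for t p w
  proof -
    let ?q = "p(Suc t := w)"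
    have "(follow v (Suc t) \<omega> = w \<and> (\<forall>s\<le>t. follow v s \<omega> = p s)) \<longleftrightarrow>
        (\<forall>s\<le>Suc t. follow v s \<omega> = ?q s)" for \<omega>
      by (auto simp: le_Suc_eq)
    then have "\<P>(\<omega> in ?M. follow v (Suc t) \<omega> = w \<and> (\<forall>s\<le>t. follow v s \<omega> = p s)) =
        \<P>(\<omega> in ?M. \<forall>s\<le>Suc t. follow v s \<omega> = ?q s)"
      by presburger
    also have "\<dots> = \<P>(\<omega> in ?M. \<forall>s\<le>t. follow v s \<omega> = p s) *
        pmf (pmf_of_set (neighbours E (p t))) w"
      unfolding path by simp
    finally show ?thesis
      using pos by (simp add: cond_prob_def)
  qed
  then show ?thesis
    unfolding simple_random_walk_def K_def[symmetric]
    using meas prob_space_axioms by auto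
qed

end

theory Submission
  imports Defs
begin

text \<open>
  The reason for the uniform law is an explicit formula for the Green function of the walk killed
  on \<open>\<partial>B\<^sub>m\<close>: the expected number of visits to \<open>u = (x, y)\<close> before absorption is
  \<open>deg(u) \<phi>(u)\<close>, where
  \<open>\<phi>(x, y) = ((m - \<bar>x\<bar>)\<^sup>2 - \<bar>y\<bar>) / (4m)\<close>.
  Along a tooth \<open>\<phi>\<close> is affine in \<open>\<bar>y\<bar>\<close>, hence harmonic; on the axis away from the root the second
  difference \<open>2\<close> of \<open>x \<mapsto> (m - \<bar>x\<bar>)\<^sup>2\<close> is cancelled by the two unit slopes into the teeth; at the root
  a unit source remains (\<open>comb_potential_Poisson\<close>).  The teeth have exactly the heights at which
  \<open>\<phi>\<close> vanishes, so \<open>\<phi>\<close> has slope \<open>1/(4m)\<close> at every point where the walk can be absorbed, and the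
  \<open>4m\<close> boundary points all receive the same flux \<open>1/(4m)\<close>.

  Full identification of the Green function is avoided.  For any nonnegative \<open>\<phi>\<close> with
  \<open>deg \<cdot> \<phi> \<ge> \<delta>\<^sub>v + \<Sum> \<phi>(neighbours)\<close> on the finite interior, induction on time shows that the truncated
  occupation sums are at most \<open>deg \<cdot> \<phi>\<close> (\<open>occupation_le\<close>).  This gives two facts.  Each hitting
  probability is at most the corresponding flux of \<open>\<phi>\<close> (\<open>first_hit_prob_le\<close>), and the occupation sums
  converge, so that absorption is almost sure and the hitting probabilities add up to \<open>1\<close>
  (\<open>first_hit_prob_sum\<close>).  Since the \<open>4m\<close> bounds \<open>1/(4m)\<close> also add up to \<open>1\<close>, all of them are
  equalities.
\<close>

section \<open>The Markov property for events of the past\<close>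

text \<open>
  The transition law is postulated only given one complete trajectory up to time \<open>t\<close>.  Any event of
  the past is a disjoint union of such trajectories, and coding a trajectory as a list makes this
  union countable, so the law can be summed over it.
\<close>
lemma walk_markov:
  fixes X :: "nat \<Rightarrow> 'a \<Rightarrow> 'v::countable"
  assumes walk: "simple_random_walk E v M X"
  shows "\<P>(\<omega> in M. map (\<lambda>s. X s \<omega>) [0..<Suc t] \<in> S \<and> X t \<omega> = u \<and> X (Suc t) \<omega> = w) =
         \<P>(\<omega> in M. map (\<lambda>s. X s \<omega>) [0..<Suc t] \<in> S \<and> X t \<omega> = u) *
           pmf (pmf_of_set (neighbours E u)) w"
    (is "?L = ?R * ?p")
proof -
  interpret prob_space M
    using walk by (simp add: simple_random_walk_def)
  have [measurable]: "X s \<in> M \<rightarrow>\<^sub>M count_space UNIV" for s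
    using walk by (simp add: simple_random_walk_def)
  define I where "I = {l \<in> S. length l = Suc t \<and> l ! t = u}"
  define past where "past l = {\<omega> \<in> space M. \<forall>s\<le>t. X s \<omega> = l ! s}" for l
  define step where "step l = {\<omega> \<in> space M. X (Suc t) \<omega> = w \<and> (\<forall>s\<le>t. X s \<omega> = l ! s)}" for l
  have path_eq: "map (\<lambda>s. X s \<omega>) [0..<Suc t] = l \<longleftrightarrow> (\<forall>s\<le>t. X s \<omega> = l ! s)"
    if "length l = Suc t" for l \<omega>
    using that by (simp add: list_eq_iff_nth_eq less_Suc_eq_le nth_append del: upt_Suc)
  have in_I: "map (\<lambda>s. X s \<omega>) [0..<Suc t] \<in> S \<and> X t \<omega> = u \<longleftrightarrow>
      (\<exists>l\<in>I. \<forall>s\<le>t. X s \<omega> = l ! s)" for \<omega>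
  proof
    assume "map (\<lambda>s. X s \<omega>) [0..<Suc t] \<in> S \<and> X t \<omega> = u"
    then have "map (\<lambda>s. X s \<omega>) [0..<Suc t] \<in> I"
      unfolding I_def by (auto simp: nth_append)
    moreover have "\<forall>s\<le>t. X s \<omega> = map (\<lambda>s. X s \<omega>) [0..<Suc t] ! s"
      by (intro path_eq[THEN iffD1, OF _ refl]) simp
    ultimately show "\<exists>l\<in>I. \<forall>s\<le>t. X s \<omega> = l ! s"
      by blast
  next
    assume "\<exists>l\<in>I. \<forall>s\<le>t. X s \<omega> = l ! s"
    then obtain l where l: "l \<in> I" "\<forall>s\<le>t. X s \<omega> = l ! s"
      by blast
    then have "map (\<lambda>s. X s \<omega>) [0..<Suc t] = l"
      by (intro path_eq[THEN iffD2]) (auto simp: I_def)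
    with l show "map (\<lambda>s. X s \<omega>) [0..<Suc t] \<in> S \<and> X t \<omega> = u"
      unfolding I_def by auto
  qed
  have disj: "l = l'" if "l \<in> I" "l' \<in> I" "\<omega> \<in> past l" "\<omega> \<in> past l'" for l l' \<omega>
    using that path_eq[of l \<omega>] path_eq[of l' \<omega>] unfolding I_def past_def by auto
  have disj_past: "disjoint_family_on past I"
    unfolding disjoint_family_on_def using disj by blast
  have disj_step: "disjoint_family_on step I"
    unfolding disjoint_family_on_def using disj by (fastforce simp: step_def past_def)
  have [measurable]: "past l \<in> sets M" "step l \<in> sets M" for l
    unfolding past_def step_def by measurable
  have single: "emeasure M (step l) = emeasure M (past l) * ennreal ?p" if "l \<in> I" for l
  proof (cases "measure M (past l) > 0")
    case True
    then have "\<P>(\<omega> in M. X (Suc t) \<omega> = w \<bar> \<forall>s\<le>t. X s \<omega> = l ! s) = ?p"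
      using walk that unfolding simple_random_walk_def past_def I_def by auto
    then have "measure M (step l) / measure M (past l) = ?p"
      by (simp add: cond_prob_def step_def past_def)
    with True have "measure M (step l) = measure M (past l) * ?p"
      by (simp add: field_simps)
    then show ?thesis
      by (simp add: emeasure_eq_measure ennreal_mult)
  next
    case False
    moreover have "measure M (step l) \<le> measure M (past l)"
      by (rule finite_measure_mono) (auto simp: step_def past_def)
    ultimately show ?thesis
      by (simp add: emeasure_eq_measure)
        (smt (verit) measure_nonneg mult_zero_left ennreal_0)
  qed
  have "ennreal ?L = emeasure M (\<Union>l\<in>I. step l)"
    unfolding emeasure_eq_measure[symmetric]
    by (rule arg_cong[where f="emeasure M"]) (use in_I in \<open>auto simp: step_def simp del: upt_Suc\<close>)
  also have "\<dots> = (\<integral>\<^sup>+l. emeasure M (step l) \<partial>count_space I)"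
    by (rule emeasure_UN_countable) (use disj_step in auto)
  also have "\<dots> = (\<integral>\<^sup>+l. emeasure M (past l) * ennreal ?p \<partial>count_space I)"
    by (rule nn_integral_cong) (simp add: single)
  also have "\<dots> = (\<integral>\<^sup>+l. emeasure M (past l) \<partial>count_space I) * ennreal ?p"
    by (rule nn_integral_multc) simp
  also have "(\<integral>\<^sup>+l. emeasure M (past l) \<partial>count_space I) = emeasure M (\<Union>l\<in>I. past l)"
    by (rule emeasure_UN_countable[symmetric]) (use disj_past in auto)
  also have "(\<Union>l\<in>I. past l) = {\<omega> \<in> space M. map (\<lambda>s. X s \<omega>) [0..<Suc t] \<in> S \<and> X t \<omega> = u}"
    using in_I by (auto simp: past_def simp del: upt_Suc)
  also have "emeasure M \<dots> * ennreal ?p = ennreal (?R * ?p)"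
    by (simp add: emeasure_eq_measure ennreal_mult)
  finally show ?thesis
    by simp
qed

section \<open>Walks absorbed on the boundary of a finite set\<close>

text \<open>
  \<open>D\<close> is the finite set on which the walk lives before its absorption in \<open>A\<close>.
\<close>
locale absorbed_walk =
  fixes E :: "'v::countable \<Rightarrow> 'v \<Rightarrow> bool" and v :: 'v and M :: "'a measure"
    and X :: "nat \<Rightarrow> 'a \<Rightarrow> 'v" and D A :: "'v set"
  assumes walk: "simple_random_walk E v M X"
    and finite_D: "finite D" and finite_A: "finite A"
    and start: "v \<in> D" and disjoint: "D \<inter> A = {}"
    and nbrs_ne: "\<And>u. u \<in> D \<Longrightarrow> neighbours E u \<noteq> {}"
    and nbrs: "\<And>u. u \<in> D \<Longrightarrow> neighbours E u \<subseteq> D \<union> A"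
begin

sublocale prob_space M
  using walk by (simp add: simple_random_walk_def)

lemma measurable_X [measurable]: "X t \<in> M \<rightarrow>\<^sub>M count_space UNIV"
  using walk by (simp add: simple_random_walk_def)

text \<open>
  The law of the killed walk at time \<open>t\<close>, a sub-probability on \<open>D\<close>; its sum over \<open>t\<close> is the Green
  function.
\<close>
definition alive :: "nat \<Rightarrow> 'v \<Rightarrow> real" where
  "alive t u = \<P>(\<omega> in M. (\<forall>s\<le>t. X s \<omega> \<notin> A) \<and> X t \<omega> = u)"

lemma alive_nonneg: "0 \<le> alive t u"
  by (simp add: alive_def)

lemma AE_start: "AE \<omega> in M. X 0 \<omega> = v"
  using walk by (simp add: simple_random_walk_def)

lemma transition:
  assumes "u \<in> D"
  shows "pmf (pmf_of_set (neighbours E u)) w = (if E u w then 1 / card (neighbours E u) else 0)"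
proof -
  have "finite (neighbours E u)"
    using nbrs[OF assms] finite_D finite_A by (meson finite_Un finite_subset)
  then show ?thesis
    using nbrs_ne[OF assms] by (auto simp: neighbours_def indicator_def)
qed

lemma markov:
  "\<P>(\<omega> in M. (\<forall>s\<le>t. X s \<omega> \<notin> A) \<and> X t \<omega> = u \<and> X (Suc t) \<omega> = w) =
     alive t u * pmf (pmf_of_set (neighbours E u)) w"
proof -
  have "map (\<lambda>s. X s \<omega>) [0..<Suc t] \<in> {l. set l \<inter> A = {}} \<longleftrightarrow> (\<forall>s\<le>t. X s \<omega> \<notin> A)" for \<omega>
    by (auto simp: disjoint_iff less_Suc_eq_le simp del: upt_Suc)
  then show ?thesis
    using walk_markov[OF walk, of t "{l. set l \<inter> A = {}}" u w] by (simp only: alive_def)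
qed

lemma AE_confined: "AE \<omega> in M. (\<forall>s\<le>t. X s \<omega> \<notin> A) \<longrightarrow> X t \<omega> \<in> D"
proof (induction t)
  case 0
  show ?case using AE_start by eventually_elim (use start in auto)
next
  case (Suc t)
  have "AE \<omega> in M. \<not> ((\<forall>s\<le>t. X s \<omega> \<notin> A) \<and> X t \<omega> = u \<and> X (Suc t) \<omega> = w)"
    if "u \<in> D" "w \<notin> D \<union> A" for u w
  proof -
    have "\<not> E u w"
      using nbrs[OF that(1)] that(2) by (auto simp: neighbours_def)
    then have "\<P>(\<omega> in M. (\<forall>s\<le>t. X s \<omega> \<notin> A) \<and> X t \<omega> = u \<and> X (Suc t) \<omega> = w) = 0"
      unfolding markov transition[OF that(1)] by simp
    then show ?thesis
      by (subst (asm) prob_Collect_eq_0) auto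
  qed
  then have "AE \<omega> in M. \<forall>u w. u \<in> D \<longrightarrow> w \<notin> D \<union> A \<longrightarrow>
      \<not> ((\<forall>s\<le>t. X s \<omega> \<notin> A) \<and> X t \<omega> = u \<and> X (Suc t) \<omega> = w)"
    unfolding AE_all_countable by auto
  with Suc.IH show ?case
    by eventually_elim (auto simp: le_Suc_eq)
qed

text \<open>
  Forward equation.  At \<open>w \<in> D\<close> it gives the next law of the killed walk, at \<open>w \<in> A\<close> the probability of
  absorption in \<open>w\<close> at time \<open>Suc t\<close>.
\<close>
lemma one_step:
  "\<P>(\<omega> in M. (\<forall>s\<le>t. X s \<omega> \<notin> A) \<and> X (Suc t) \<omega> = w) =
     (\<Sum>u | u \<in> D \<and> E u w. alive t u / card (neighbours E u))"
proof -
  have "\<P>(\<omega> in M. (\<forall>s\<le>t. X s \<omega> \<notin> A) \<and> X (Suc t) \<omega> = w) =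
      \<P>(\<omega> in M. \<exists>u\<in>D. (\<forall>s\<le>t. X s \<omega> \<notin> A) \<and> X t \<omega> = u \<and> X (Suc t) \<omega> = w)"
    using AE_confined[of t] by (intro prob_eq_AE) auto
  also have "\<dots> = (\<Sum>u\<in>D. \<P>(\<omega> in M. (\<forall>s\<le>t. X s \<omega> \<notin> A) \<and> X t \<omega> = u \<and> X (Suc t) \<omega> = w))"
    by (intro prob_sum finite_D) auto
  also have "\<dots> = (\<Sum>u\<in>D. if E u w then alive t u / card (neighbours E u) else 0)"
    unfolding markov by (intro sum.cong refl) (simp add: transition)
  also have "\<dots> = (\<Sum>u | u \<in> D \<and> E u w. alive t u / card (neighbours E u))"
    using finite_D by (simp add: sum.If_cases Int_def)
  finally show ?thesis .
qed

lemma alive_0: "alive 0 u \<le> (if u = v then 1 else 0)"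
proof (cases "u = v")
  case False
  then have "alive 0 u = 0"
    unfolding alive_def using AE_start by (subst prob_Collect_eq_0) auto
  with False show ?thesis by simp
qed (simp add: alive_def)

lemma alive_Suc:
  assumes "w \<in> D"
  shows "alive (Suc t) w = (\<Sum>u | u \<in> D \<and> E u w. alive t u / card (neighbours E u))"
proof -
  have "(\<forall>s\<le>Suc t. X s \<omega> \<notin> A) \<and> X (Suc t) \<omega> = w \<longleftrightarrow>
      (\<forall>s\<le>t. X s \<omega> \<notin> A) \<and> X (Suc t) \<omega> = w" for \<omega>
    using assms disjoint by (auto simp: le_Suc_eq)
  then show ?thesis
    by (simp only: alive_def[of "Suc t"] one_step)
qed

definition first_at :: "'v \<Rightarrow> nat \<Rightarrow> 'a set" where
  "first_at z t = {\<omega> \<in> space M. (\<forall>s<t. X s \<omega> \<notin> A) \<and> X t \<omega> = z}"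

lemma first_hit_at_iff:
  assumes "z \<in> A"
  shows "first_hit_at X A z \<omega> \<longleftrightarrow> (\<exists>t. (\<forall>s<t. X s \<omega> \<notin> A) \<and> X t \<omega> = z)"
proof
  assume hit: "first_hit_at X A z \<omega>"
  then have "Inf {t. X t \<omega> \<in> A} \<in> {t. X t \<omega> \<in> A}"
    unfolding first_hit_at_def by (intro Inf_nat_def1) auto
  moreover have "X s \<omega> \<notin> A" if "s < Inf {t. X t \<omega> \<in> A}" for s
    using that cInf_lower[of s "{t. X t \<omega> \<in> A}"] by auto
  ultimately show "\<exists>t. (\<forall>s<t. X s \<omega> \<notin> A) \<and> X t \<omega> = z"
    using hit unfolding first_hit_at_def by blast
next
  assume "\<exists>t. (\<forall>s<t. X s \<omega> \<notin> A) \<and> X t \<omega> = z"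
  then obtain t where t: "\<forall>s<t. X s \<omega> \<notin> A" "X t \<omega> = z" by blast
  then have "Inf {t. X t \<omega> \<in> A} = t"
    using assms by (intro cInf_eq_minimum) (auto simp: not_less[symmetric])
  with t assms show "first_hit_at X A z \<omega>"
    unfolding first_hit_at_def by auto
qed

text \<open>
  The sum starts at time \<open>1\<close> because the starting point does not lie in \<open>A\<close>.
\<close>
lemma first_hit_sums:
  assumes "z \<in> A"
  shows "(\<lambda>t. prob (first_at z (Suc t))) sums \<P>(\<omega> in M. first_hit_at X A z \<omega>)"
proof -
  have "(\<lambda>t. prob (first_at z t)) sums prob (\<Union>t. first_at z t)"
  proof (rule finite_measure_UNION)
    show "disjoint_family (first_at z)"
      unfolding disjoint_family_on_def first_at_def using assms by (auto, metis nat_neq_iff)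
  qed (auto simp: first_at_def)
  moreover have "(\<Union>t. first_at z t) = {\<omega> \<in> space M. first_hit_at X A z \<omega>}"
    using first_hit_at_iff[OF assms] by (auto simp: first_at_def)
  moreover have "prob (first_at z 0) = 0"
  proof -
    have "v \<noteq> z" using start disjoint assms by auto
    then show ?thesis
      unfolding first_at_def using AE_start by (subst prob_Collect_eq_0) auto
  qed
  ultimately show ?thesis
    using sums_Suc_iff[of "\<lambda>t. prob (first_at z t)"] by simp
qed

lemma card_nbrs_pos: "u \<in> D \<Longrightarrow> 0 < card (neighbours E u)"
  using nbrs_ne nbrs finite_D finite_A by (metis card_gt_0_iff finite_Un finite_subset)

text \<open>
  \<open>\<phi>\<close> stands for an upper bound of the Green function divided by the degree.  After this division the
  forward equation has no transition probabilities left: the source at \<open>v\<close> and the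
  values of \<open>\<phi>\<close> at the neighbours in \<open>D\<close> are compared with \<open>deg \<cdot> \<phi>\<close>.
\<close>
context
  fixes \<phi> :: "'v \<Rightarrow> real"
  assumes \<phi>_nonneg: "\<And>u. u \<in> D \<Longrightarrow> 0 \<le> \<phi> u"
    and superharmonic: "\<And>w. w \<in> D \<Longrightarrow>
      (if w = v then 1 else 0) + (\<Sum>u | u \<in> D \<and> E u w. \<phi> u) \<le> card (neighbours E w) * \<phi> w"
begin

text \<open>
  Minimality of the Green function: the occupation sums arise by iterating
  \<open>G \<mapsto> \<delta>\<^sub>v + G P\<close> from \<open>0\<close>, a monotone map for which \<open>deg \<cdot> \<phi>\<close> is a supersolution.
\<close>
lemma occupation_le:
  assumes "w \<in> D"
  shows "(\<Sum>t<n. alive t w) \<le> card (neighbours E w) * \<phi> w"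
  using assms
proof (induction n arbitrary: w)
  case 0
  then show ?case by (simp add: \<phi>_nonneg)
next
  case (Suc n)
  have "(\<Sum>t<Suc n. alive t w) = alive 0 w + (\<Sum>t<n. alive (Suc t) w)"
    by (rule sum.lessThan_Suc_shift)
  also have "(\<Sum>t<n. alive (Suc t) w) =
      (\<Sum>u | u \<in> D \<and> E u w. (\<Sum>t<n. alive t u) / card (neighbours E u))"
    unfolding alive_Suc[OF Suc.prems] sum_divide_distrib by (rule sum.swap)
  also have "\<dots> \<le> (\<Sum>u | u \<in> D \<and> E u w. \<phi> u)"
    using Suc.IH card_nbrs_pos by (intro sum_mono) (auto simp: divide_le_eq mult.commute)
  finally show ?case
    using superharmonic[OF Suc.prems] alive_0[of w] by linarith
qed

lemma first_hit_prob_le: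
  assumes "z \<in> A"
  shows "\<P>(\<omega> in M. first_hit_at X A z \<omega>) \<le> (\<Sum>u | u \<in> D \<and> E u z. \<phi> u)"
proof -
  have "(\<Sum>t<n. prob (first_at z (Suc t))) \<le> (\<Sum>u | u \<in> D \<and> E u z. \<phi> u)" for n
  proof -
    have "prob (first_at z (Suc t)) =
        (\<Sum>u | u \<in> D \<and> E u z. alive t u / card (neighbours E u))" for t
      unfolding first_at_def less_Suc_eq_le by (rule one_step)
    then have "(\<Sum>t<n. prob (first_at z (Suc t))) =
        (\<Sum>u | u \<in> D \<and> E u z. (\<Sum>t<n. alive t u) / card (neighbours E u))"
      unfolding sum_divide_distrib by (simp add: sum.swap[of _ "{..<n}"])
    also have "\<dots> \<le> (\<Sum>u | u \<in> D \<and> E u z. \<phi> u)"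
      using occupation_le card_nbrs_pos by (intro sum_mono) (auto simp: divide_le_eq mult.commute)
    finally show ?thesis .
  qed
  then show ?thesis
    using first_hit_sums[OF assms] by (metis suminf_le_const sums_iff)
qed

text \<open>
  The occupation sums are bounded, so the probability of being alive at time \<open>t\<close>
  is summable in \<open>t\<close> and tends to zero.
\<close>
lemma AE_hit: "AE \<omega> in M. \<exists>t. X t \<omega> \<in> A"
proof -
  have "\<P>(\<omega> in M. \<forall>t. X t \<omega> \<notin> A) \<le> (\<Sum>u\<in>D. alive t u)" for t
  proof -
    have "\<P>(\<omega> in M. \<forall>t. X t \<omega> \<notin> A) \<le> \<P>(\<omega> in M. \<exists>u\<in>D. (\<forall>s\<le>t. X s \<omega> \<notin> A) \<and> X t \<omega> = u)"
      using AE_confined[of t] by (intro finite_measure_mono_AE) auto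
    also have "\<dots> = (\<Sum>u\<in>D. alive t u)"
      unfolding alive_def by (intro prob_sum finite_D) auto
    finally show ?thesis .
  qed
  moreover have "(\<lambda>t. \<Sum>u\<in>D. alive t u) \<longlonglongrightarrow> (\<Sum>u\<in>D. 0)"
  proof (intro tendsto_sum summable_LIMSEQ_zero)
    fix u assume "u \<in> D"
    show "summable (\<lambda>t. alive t u)"
      using occupation_le[OF \<open>u \<in> D\<close>] alive_nonneg by (rule summableI_nonneg_bounded[rotated])
  qed
  ultimately have "\<P>(\<omega> in M. \<forall>t. X t \<omega> \<notin> A) \<le> 0"
    by (intro LIMSEQ_le_const[where X="\<lambda>t. \<Sum>u\<in>D. alive t u"]) auto
  then have "\<P>(\<omega> in M. \<forall>t. X t \<omega> \<notin> A) = 0"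
    by (simp add: antisym)
  then show ?thesis
    by (subst (asm) prob_Collect_eq_0) auto
qed

lemma first_hit_prob_sum: "(\<Sum>z\<in>A. \<P>(\<omega> in M. first_hit_at X A z \<omega>)) = 1"
proof -
  have meas: "{\<omega> \<in> space M. first_hit_at X A z \<omega>} \<in> events" if "z \<in> A" for z
    unfolding first_hit_at_iff[OF that] by measurable
  have "(\<Sum>z\<in>A. \<P>(\<omega> in M. first_hit_at X A z \<omega>)) = \<P>(\<omega> in M. \<exists>z\<in>A. first_hit_at X A z \<omega>)"
  proof (rule prob_sum[symmetric])
    have "{\<omega> \<in> space M. \<exists>z\<in>A. first_hit_at X A z \<omega>} =
        (\<Union>z\<in>A. {\<omega> \<in> space M. first_hit_at X A z \<omega>})"
      by auto
    also have "\<dots> \<in> events"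
      using finite_A meas by auto
    finally show "{\<omega> \<in> space M. \<exists>z\<in>A. first_hit_at X A z \<omega>} \<in> events" .
  qed (auto simp: finite_A meas, auto simp: first_hit_at_def)
  also have "\<dots> = \<P>(\<omega> in M. \<exists>t. X t \<omega> \<in> A)"
  proof -
    have "(\<exists>z\<in>A. first_hit_at X A z \<omega>) \<longleftrightarrow> (\<exists>t. X t \<omega> \<in> A)" for \<omega>
      unfolding first_hit_at_def using Inf_nat_def1[of "{t. X t \<omega> \<in> A}"] by auto
    then show ?thesis by simp
  qed
  also have "\<dots> = 1"
    using AE_hit by (subst prob_Collect_eq_1) auto
  finally show ?thesis .
qed

text \<open>
  Bounds on the hitting probabilities with total mass at most \<open>1\<close> leave no room, since the hitting
  probabilities themselves have total mass \<open>1\<close>.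
\<close>
lemma first_hit_prob_eq:
  assumes flux: "\<And>z. z \<in> A \<Longrightarrow> (\<Sum>u | u \<in> D \<and> E u z. \<phi> u) \<le> c z"
    and total: "(\<Sum>z\<in>A. c z) \<le> 1" and "z \<in> A"
  shows "\<P>(\<omega> in M. first_hit_at X A z \<omega>) = c z"
proof -
  have le: "\<P>(\<omega> in M. first_hit_at X A i \<omega>) \<le> c i" if "i \<in> A" for i
    using first_hit_prob_le[OF that] flux[OF that] by linarith
  have "(\<Sum>z\<in>A. \<P>(\<omega> in M. first_hit_at X A z \<omega>)) = (\<Sum>z\<in>A. c z)"
    using first_hit_prob_sum total sum_mono[of A _ c, OF le] by linarith
  from this le \<open>z \<in> A\<close> finite_A show ?thesis
    by (rule sum_mono_inv)
qed

end
end

section \<open>The geometry of the comb\<close>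

lemma mem_comb_ball:
  "(x, y) \<in> comb_ball m \<longleftrightarrow> \<bar>x\<bar> \<le> int m \<and> \<bar>y\<bar> \<le> (int m - \<bar>x\<bar>)\<^sup>2"
  by (auto simp: comb_ball_def height_def)

definition comb_interior :: "nat \<Rightarrow> (int \<times> int) set" where
  "comb_interior m = {(x, y). \<bar>x\<bar> < int m \<and> \<bar>y\<bar> < (int m - \<bar>x\<bar>)\<^sup>2}"

lemma neighbours_comb:
  "neighbours comb_adj (x, y) =
     (if y = 0 then {(x + 1, 0), (x - 1, 0), (x, 1), (x, -1)} else {(x, y + 1), (x, y - 1)})"
  by (auto simp: neighbours_def comb_adj_def)

lemma comb_adj_commute: "comb_adj u w \<longleftrightarrow> comb_adj w u"
  by (auto simp: comb_adj_def)

lemma neighbours_comb_interior: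
  assumes "u \<in> comb_interior m"
  shows "neighbours comb_adj u \<subseteq> comb_ball m"
proof -
  obtain x y where u: "u = (x, y)" by force
  have xy: "\<bar>x\<bar> < int m" "\<bar>y\<bar> + 1 \<le> (int m - \<bar>x\<bar>)\<^sup>2"
    using assms by (auto simp: u comb_interior_def)
  then show ?thesis
    by (auto simp: u neighbours_comb mem_comb_ball)
qed

text \<open>
  Only the tips of the teeth, including the degenerate teeth of height \<open>0\<close> at \<open>x = \<plusminus>m\<close>, can be left
  in one step: below a tip there is room for a vertical step, and a point of the axis with
  \<open>\<bar>x\<bar> < m\<close> has both horizontal neighbours in the ball.
\<close>
lemma comb_inner_boundary:
  "inner_boundary comb_adj (comb_ball m) = {(x, y). \<bar>x\<bar> \<le> int m \<and> \<bar>y\<bar> = (int m - \<bar>x\<bar>)\<^sup>2}"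
proof -
  have "(x, y) \<in> inner_boundary comb_adj (comb_ball m) \<longleftrightarrow>
      \<bar>x\<bar> \<le> int m \<and> \<bar>y\<bar> = (int m - \<bar>x\<bar>)\<^sup>2" for x y
  proof
    assume L: "(x, y) \<in> inner_boundary comb_adj (comb_ball m)"
    then have "(x, y) \<notin> comb_interior m"
      using neighbours_comb_interior[of "(x, y)" m]
      by (auto simp: inner_boundary_def neighbours_def)
    moreover have ball: "\<bar>x\<bar> \<le> int m" "\<bar>y\<bar> \<le> (int m - \<bar>x\<bar>)\<^sup>2"
      using L by (auto simp: inner_boundary_def mem_comb_ball)
    ultimately show "\<bar>x\<bar> \<le> int m \<and> \<bar>y\<bar> = (int m - \<bar>x\<bar>)\<^sup>2"
      by (cases "\<bar>x\<bar> = int m") (auto simp: comb_interior_def)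
  next
    assume R: "\<bar>x\<bar> \<le> int m \<and> \<bar>y\<bar> = (int m - \<bar>x\<bar>)\<^sup>2"
    \<comment> \<open>one step outwards along the tooth; at height 0 either direction leaves the ball\<close>
    define y' where "y' = (if y \<ge> 0 then y + 1 else y - 1)"
    have "comb_adj (x, y) (x, y')" "(x, y') \<notin> comb_ball m"
      using R by (auto simp: comb_adj_def y'_def mem_comb_ball)
    with R show "(x, y) \<in> inner_boundary comb_adj (comb_ball m)"
      by (auto simp: inner_boundary_def mem_comb_ball)
  qed
  then show ?thesis by auto
qed

lemma comb_ball_split:
  "comb_ball m = comb_interior m \<union> inner_boundary comb_adj (comb_ball m)"
proof -
  have "(x, y) \<in> comb_ball m \<longleftrightarrow> (x, y) \<in> comb_interior m \<union> inner_boundary comb_adj (comb_ball m)"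
    for x y
    unfolding comb_inner_boundary
    by (cases "\<bar>x\<bar> = int m") (auto simp: mem_comb_ball comb_interior_def)
  then show ?thesis by auto
qed

lemma finite_comb_ball: "finite (comb_ball m)"
proof (rule finite_subset)
  show "comb_ball m \<subseteq> {-int m..int m} \<times> {-(int m)\<^sup>2..(int m)\<^sup>2}"
  proof
    fix u assume "u \<in> comb_ball m"
    then obtain x y where u: "u = (x, y)" "\<bar>x\<bar> \<le> int m" "\<bar>y\<bar> \<le> (int m - \<bar>x\<bar>)\<^sup>2"
      by (cases u) (auto simp: mem_comb_ball)
    moreover have "(int m - \<bar>x\<bar>)\<^sup>2 \<le> (int m)\<^sup>2"
      using u by (intro power_mono) auto
    ultimately have "\<bar>y\<bar> \<le> (int m)\<^sup>2" by linarith
    with u show "u \<in> {-int m..int m} \<times> {-(int m)\<^sup>2..(int m)\<^sup>2}" by auto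
  qed
qed simp

text \<open>
  The upper tips are indexed by \<open>-m \<le> x \<le> m\<close>.  The lower tips are indexed by \<open>-m < x < m\<close> only,
  since at \<open>x = \<plusminus>m\<close> the two tips coincide.
\<close>
lemma card_comb_inner_boundary:
  assumes "m \<ge> 1"
  shows "card (inner_boundary comb_adj (comb_ball m)) = 4 * m"
proof -
  define top where "top = (\<lambda>x. (x, (int m - \<bar>x\<bar>)\<^sup>2)) ` {-int m..int m}"
  define bot where "bot = (\<lambda>x. (x, - (int m - \<bar>x\<bar>)\<^sup>2)) ` {-int m<..<int m}"
  have "inner_boundary comb_adj (comb_ball m) = top \<union> bot"
  proof -
    have "(x, y) \<in> inner_boundary comb_adj (comb_ball m) \<longleftrightarrow> (x, y) \<in> top \<union> bot" for x y
      unfolding comb_inner_boundary top_def bot_def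
      by (cases "\<bar>x\<bar> = int m") (auto simp: image_iff abs_if split: if_splits)
    then show ?thesis by auto
  qed
  moreover have "top \<inter> bot = {}"
  proof -
    have False if "(int m - \<bar>x\<bar>)\<^sup>2 = - (int m - \<bar>x\<bar>)\<^sup>2" "- int m < x" "x < int m" for x
      using that by (simp add: eq_neg_iff_add_eq_0)
    then show ?thesis by (auto simp: top_def bot_def)
  qed
  moreover have "card top = 2 * m + 1"
    unfolding top_def by (subst card_image) (auto simp: inj_on_def)
  moreover have "card bot = 2 * m - 1"
    unfolding bot_def by (subst card_image) (auto simp: inj_on_def)
  moreover have "finite top" "finite bot"
    by (simp_all add: top_def bot_def)
  ultimately show ?thesis
    using assms by (simp add: card_Un_disjoint)
qed

section \<open>The Green function of the comb\<close>

text \<open>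
  The Green function of the ball at the root, divided by the degree.  The factor \<open>1/(4m)\<close>
  normalises the source at the root to \<open>1\<close>.
\<close>
definition comb_potential :: "nat \<Rightarrow> int \<times> int \<Rightarrow> real" where
  "comb_potential m = (\<lambda>(x, y). real_of_int ((int m - \<bar>x\<bar>)\<^sup>2 - \<bar>y\<bar>) / (4 * real m))"

lemma comb_potential_nonneg: "u \<in> comb_ball m \<Longrightarrow> 0 \<le> comb_potential m u"
  unfolding comb_potential_def case_prod_unfold
  by (intro divide_nonneg_nonneg, unfold of_int_0_le_iff)
    (cases u, auto simp: mem_comb_ball)

text \<open>
  On a tooth both sides agree because \<open>\<phi>\<close> is affine there.  On the axis with \<open>k = m - \<bar>x\<bar>\<close> and up to
  the factor \<open>1/(4m)\<close> the neighbours contribute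
  \<open>(k + 1)\<^sup>2 + (k - 1)\<^sup>2 + 2(k\<^sup>2 - 1) = 4k\<^sup>2\<close>; at the root, where both horizontal neighbours have
  \<open>k = m - 1\<close>, they contribute \<open>4m\<^sup>2 - 4m\<close>, and the missing \<open>4m\<close> is the unit source.
\<close>
lemma comb_potential_Poisson:
  assumes "m \<ge> 1"
  shows "(if w = (0, 0) then 1 else 0) + (\<Sum>u\<in>neighbours comb_adj w. comb_potential m u) =
    card (neighbours comb_adj w) * comb_potential m w"
proof -
  obtain x y where w: "w = (x, y)" by force
  consider "y \<noteq> 0" | "y = 0" "x = 0" | "y = 0" "x > 0" | "y = 0" "x < 0" by linarith
  then show ?thesis
  proof cases
    case 1
    then have slope: "\<bar>y + 1\<bar> = 2 * \<bar>y\<bar> - \<bar>y - 1\<bar>" by arith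
    have "comb_potential m (x, y + 1) + comb_potential m (x, y - 1) = 2 * comb_potential m (x, y)"
      unfolding comb_potential_def case_prod_conv slope
      by (simp add: add_divide_distrib diff_divide_distrib)
    with 1 show ?thesis
      by (simp add: w neighbours_comb)
  next
    case 2
    with assms show ?thesis
      by (simp add: w neighbours_comb comb_potential_def field_simps power2_eq_square)
  next
    case 3
    with assms show ?thesis
      by (simp add: w neighbours_comb comb_potential_def field_simps power2_eq_square)
  next
    case 4
    with assms show ?thesis
      by (simp add: w neighbours_comb comb_potential_def field_simps power2_eq_square)
  qed
qed

text \<open>
  A tip has one neighbour in the interior: the next vertex down its tooth, or the adjacent axis vertex
  when the tooth has height \<open>0\<close>.  In both cases \<open>\<phi>\<close> is \<open>1/(4m)\<close> there; on the axis this is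
  the choice \<open>h(1) = 1\<close>.
\<close>
lemma comb_flux_le:
  assumes "m \<ge> 1" and z: "z \<in> inner_boundary comb_adj (comb_ball m)"
  shows "(\<Sum>u | u \<in> comb_interior m \<and> comb_adj u z. comb_potential m u) \<le> 1 / (4 * real m)"
proof -
  obtain x y where xy: "z = (x, y)" "\<bar>x\<bar> \<le> int m" "\<bar>y\<bar> = (int m - \<bar>x\<bar>)\<^sup>2"
    using z by (auto simp: comb_inner_boundary)
  \<comment> \<open>the only interior neighbour of the tip\<close>
  define p where "p = (if \<bar>x\<bar> = int m then (x - sgn x, 0) else (x, y - sgn y))"
  have "{u. u \<in> comb_interior m \<and> comb_adj u z} \<subseteq> {p}"
  proof (cases "\<bar>x\<bar> = int m")
    case True
    then show ?thesis
      using xy by (auto simp: p_def comb_interior_def comb_adj_def sgn_if)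
  next
    case False
    then have "0 < (int m - \<bar>x\<bar>)\<^sup>2" by simp
    then have "y \<noteq> 0" using xy by auto
    with False xy show ?thesis
      by (auto simp: p_def comb_interior_def comb_adj_def sgn_if)
  qed
  moreover have p: "comb_potential m p = 1 / (4 * real m)"
  proof (cases "\<bar>x\<bar> = int m")
    case True
    then have x: "\<bar>x - sgn x\<bar> = int m - 1" using assms by (auto simp: sgn_if)
    have "p = (x - sgn x, 0)"
      using True by (simp add: p_def)
    then show ?thesis
      by (simp only: comb_potential_def case_prod_conv x) simp
  next
    case False
    then have "0 < (int m - \<bar>x\<bar>)\<^sup>2" by simp
    then have "y \<noteq> 0" using xy by auto
    then have y: "\<bar>y - sgn y\<bar> = (int m - \<bar>x\<bar>)\<^sup>2 - 1" using xy(3) by (auto simp: sgn_if)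
    have "p = (x, y - sgn y)"
      using False by (simp add: p_def)
    then show ?thesis
      by (simp only: comb_potential_def case_prod_conv y) simp
  qed
  ultimately have "(\<Sum>u | u \<in> comb_interior m \<and> comb_adj u z. comb_potential m u) \<le>
      (\<Sum>u\<in>{p}. comb_potential m u)"
    by (intro sum_mono2) auto
  then show ?thesis using p by simp
qed

theorem theorem1p2:
  fixes m :: nat
    and M :: "'a measure"
    and X :: "nat \<Rightarrow> 'a \<Rightarrow> int \<times> int"
  assumes "m \<ge> 1"
    and "simple_random_walk comb_adj (0, 0) M X"
  shows "harmonic_measure comb_adj M X (comb_ball m) =
         uniform_count_measure (inner_boundary comb_adj (comb_ball m))"
proof -
  define A where "A = inner_boundary comb_adj (comb_ball m)"
  have ball: "comb_ball m = comb_interior m \<union> A"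
    unfolding A_def by (rule comb_ball_split)
  have fin: "finite (comb_interior m)" "finite A"
    using finite_comb_ball[of m] unfolding ball by auto
  interpret absorbed_walk comb_adj "(0, 0)" M X "comb_interior m" A
  proof
    show "(0, 0) \<in> comb_interior m"
      using assms(1) by (simp add: comb_interior_def)
    show "comb_interior m \<inter> A = {}"
      by (auto simp: A_def comb_inner_boundary comb_interior_def)
    show "neighbours comb_adj u \<subseteq> comb_interior m \<union> A" if "u \<in> comb_interior m" for u
      using neighbours_comb_interior[OF that] by (simp only: ball)
    show "neighbours comb_adj u \<noteq> {}" for u
      by (cases u) (simp add: neighbours_comb)
  qed (use assms(2) fin in auto)
  have prob_hit: "\<P>(\<omega> in M. first_hit_at X A z \<omega>) = 1 / card A" if "z \<in> A" for z
  proof (rule first_hit_prob_eq[where \<phi> = "comb_potential m" and c = "\<lambda>_. 1 / card A"])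
    show "0 \<le> comb_potential m u" if "u \<in> comb_interior m" for u
      using that by (intro comb_potential_nonneg) (simp add: ball)
    show "(if w = (0, 0) then 1 else 0) +
        (\<Sum>u | u \<in> comb_interior m \<and> comb_adj u w. comb_potential m u)
        \<le> card (neighbours comb_adj w) * comb_potential m w"
      if w: "w \<in> comb_interior m" for w
    proof -
      have sub: "neighbours comb_adj w \<subseteq> comb_ball m"
        by (rule neighbours_comb_interior[OF w])
      \<comment> \<open>neighbours on the boundary may be added because the potential is nonnegative there\<close>
      have "(\<Sum>u | u \<in> comb_interior m \<and> comb_adj u w. comb_potential m u) \<le>
          (\<Sum>u\<in>neighbours comb_adj w. comb_potential m u)"
      proof (rule sum_mono2)
        show "finite (neighbours comb_adj w)"
          using sub finite_comb_ball by (rule finite_subset)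
        show "{u. u \<in> comb_interior m \<and> comb_adj u w} \<subseteq> neighbours comb_adj w"
          by (auto simp: neighbours_def comb_adj_commute)
      qed (use sub comb_potential_nonneg in auto)
      then show ?thesis
        using comb_potential_Poisson[OF assms(1), of w] by linarith
    qed
    show "(\<Sum>u | u \<in> comb_interior m \<and> comb_adj u z. comb_potential m u) \<le> 1 / card A"
      if "z \<in> A" for z
      using comb_flux_le[OF assms(1)] that card_comb_inner_boundary[OF assms(1)]
      by (simp add: A_def)
  qed (use that in simp_all)
  show ?thesis
    unfolding harmonic_measure_def uniform_count_measure_def point_measure_def A_def[symmetric]
    by (rule density_cong) (auto simp: AE_count_space prob_hit)
qed

end
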